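(* Let $T_{\mathrm{odd}}$ (resp. $T_{\mathrm{even}}$) be the rooted tree whose nodes are the Baxter permutations of odd length (resp. of even length, including the empty permutation of length $0$) that are fixed under $180^{\circ}$ rotation, whose root is the permutation $1$ (resp. the empty permutation), and in which the parent of a node $w$ of length $n\ge 2$ is the permutation of length $n-2$ obtained by deleting the entries $n$ and $1$ from $w$ and decreasing all remaining entries by $1$. Let $A_{\mathrm{odd}}$ (resp. $A_{\mathrm{even}}$) be the abstract rooted tree with nodes labelled by pairs of nonnegative integers, with root labelled $(1,1)$ (resp. $(0,0)$), in which the root $(0,0)$ has the two children $(1,2)$ and $(2,1)$, and in which every node labelled $(i,j)$ with $i,j\ge 1$ has exactly $i+j$ children, labelled $$(1,j+2),\ (2,j+1),\ (3,j+1),\ \ldots,\ (i,j+1),\ (i+1,j),\ (i+1,j-1),\ \ldots,\ (i+1,2),\ (i+2,1)$$ (that is, the $k$-th of the first $i$ children is $(k,j+1)$ except that the first is $(1,j+2)$, and the remaining $j$ children are $(i+1,m)$ for $m=j,j-1,\ldots,2$ followed by $(i+2,1)$). Then $T_{\mathrm{odd}}$ is isomorphic to $A_{\mathrm{odd}}$ and $T_{\mathrm{even}}$ is isomorphic to $A_{\mathrm{even}}$ as rooted trees.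
   Context: A permutation $w=w_1\ldots w_n$ is a Baxter permutation if there are no indices $i<j<j+1<k$ with $w_j<w_k<w_i<w_{j+1}$ (pattern 3-14-2) and no indices $i<j<j+1<k$ with $w_{j+1}<w_i<w_k<w_j$ (pattern 2-41-3). A permutation $w$ of length $n$ is fixed under $180^{\circ}$ rotation (of its permutation matrix) if $w_{n+1-i}=n+1-w_i$ for all $i$. The paper uses the convention that the empty permutation is the root of the even-length tree, with children $12$ and $21$. *)

theory Defs
  imports "HOL-Combinatorics.Multiset_Permutations"
begin

text \<open>Arcs point from parent to child.\<close>

record 'a rooted_digraph =
  nodes :: "'a set"
  root :: 'a
  arcs :: "('a \<times> 'a) set"

definition rooted_tree :: "'a rooted_digraph \<Rightarrow> bool" where
  "rooted_tree T \<longleftrightarrow>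
     root T \<in> nodes T \<and>
     arcs T \<subseteq> nodes T \<times> nodes T \<and>
     (\<forall>u. (u, root T) \<notin> arcs T) \<and>
     (\<forall>v \<in> nodes T - {root T}. \<exists>!u. (u, v) \<in> arcs T) \<and>
     (\<forall>v \<in> nodes T. (root T, v) \<in> (arcs T)\<^sup>*)"

definition rooted_tree_isomorphic :: "'a rooted_digraph \<Rightarrow> 'b rooted_digraph \<Rightarrow> bool" where
  "rooted_tree_isomorphic S T \<longleftrightarrow>
     rooted_tree S \<and> rooted_tree T \<and>
     (\<exists>f. bij_betw f (nodes S) (nodes T) \<and>
          f (root S) = root T \<and>
          (\<forall>u \<in> nodes S. \<forall>v \<in> nodes S. (u, v) \<in> arcs S \<longleftrightarrow> (f u, f v) \<in> arcs T))"

text \<open>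
  A permutation of length \<open>n\<close> is its one-line notation, a list enumerating \<open>{1..n}\<close>;
  list positions are counted from \<open>0\<close>, entries from \<open>1\<close>.
\<close>

definition is_permutation :: "nat list \<Rightarrow> bool" where
  "is_permutation w \<longleftrightarrow> w \<in> permutations_of_set {1..length w}"

definition baxter :: "nat list \<Rightarrow> bool" where
  "baxter w \<longleftrightarrow>
     is_permutation w \<and>
     \<not> (\<exists>i j k. i < j \<and> j + 1 < k \<and> k < length w \<and>
          w ! j < w ! k \<and> w ! k < w ! i \<and> w ! i < w ! (j + 1)) \<and>
     \<not> (\<exists>i j k. i < j \<and> j + 1 < k \<and> k < length w \<and>
          w ! (j + 1) < w ! i \<and> w ! i < w ! k \<and> w ! k < w ! j)"

definition rotation_fixed :: "nat list \<Rightarrow> bool" where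
  "rotation_fixed w \<longleftrightarrow>
     (\<forall>i < length w. w ! (length w - 1 - i) = length w + 1 - w ! i)"

definition delete_extremes :: "nat list \<Rightarrow> nat list" where
  "delete_extremes w = map (\<lambda>x. x - 1) (filter (\<lambda>x. x \<noteq> length w \<and> x \<noteq> 1) w)"

definition deletion_tree :: "nat list set \<Rightarrow> nat list \<Rightarrow> nat list rooted_digraph" where
  "deletion_tree V r =
     \<lparr>nodes = V, root = r, arcs = {(delete_extremes w, w) | w. w \<in> V \<and> length w \<ge> 2}\<rparr>"

definition T_odd :: "nat list rooted_digraph" where
  "T_odd = deletion_tree {w. baxter w \<and> rotation_fixed w \<and> odd (length w)} [1]"

definition T_even :: "nat list rooted_digraph" where
  "T_even = deletion_tree {w. baxter w \<and> rotation_fixed w \<and> even (length w)} []"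

text \<open>
  The generating tree of a succession rule \<open>C\<close>, which lists the labels of the children of a
  node with a given label.  Since distinct nodes may carry the same label, a node is a pair of
  its address (the successive child positions on the path from the root) and its label.
\<close>

inductive_set generating_tree_nodes :: "('l \<Rightarrow> 'l list) \<Rightarrow> 'l \<Rightarrow> (nat list \<times> 'l) set"
  for C :: "'l \<Rightarrow> 'l list" and r :: 'l where
  root: "([], r) \<in> generating_tree_nodes C r"
| child: "(p, l) \<in> generating_tree_nodes C r \<Longrightarrow> k < length (C l) \<Longrightarrow>
    (p @ [k], C l ! k) \<in> generating_tree_nodes C r"

definition generating_tree ::
  "('l \<Rightarrow> 'l list) \<Rightarrow> 'l \<Rightarrow> (nat list \<times> 'l) rooted_digraph" where
  "generating_tree C r =
     \<lparr>nodes = generating_tree_nodes C r,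
      root = ([], r),
      arcs = {((p, l), (p @ [k], C l ! k)) | p l k.
        (p, l) \<in> generating_tree_nodes C r \<and> k < length (C l)}\<rparr>"

text \<open>
  Labels with exactly one zero component never occur in the trees below; they get no children.
\<close>

fun child_labels :: "nat \<times> nat \<Rightarrow> (nat \<times> nat) list" where
  "child_labels (i, j) =
     (if i = 0 \<and> j = 0 then [(1, 2), (2, 1)]
      else if i \<ge> 1 \<and> j \<ge> 1 then
        [(1, j + 2)] @ map (\<lambda>k. (k, j + 1)) [2..<i + 1] @
        map (\<lambda>m. (i + 1, m)) (rev [2..<j + 1]) @ [(i + 2, 1)]
      else [])"

definition A_odd :: "(nat list \<times> nat \<times> nat) rooted_digraph" where
  "A_odd = generating_tree child_labels (1, 1)"

definition A_even :: "(nat list \<times> nat \<times> nat) rooted_digraph" where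
  "A_even = generating_tree child_labels (0, 0)"

end

theory Submission
  imports Defs
begin

text \<open>
  Inserting a new maximum into a Baxter permutation preserves the Baxter property exactly when it
  is placed immediately before a left-to-right maximum or immediately after a right-to-left
  maximum.  In a rotation-invariant permutation the position of the new minimum is then forced by
  that of the new maximum, so a nonempty \<open>w\<close> with \<open>i\<close> left-to-right and \<open>j\<close> right-to-left maxima
  has \<open>i + j\<close> children, and the pair \<open>(i, j)\<close> is its label.  Inserting before the \<open>k\<close>-th
  left-to-right maximum leaves \<open>k\<close> left-to-right maxima and adds one right-to-left maximum, or two
  if \<open>k = 1\<close>, because then the new minimum comes last; the other insertions are mirror images.
  The labels of the children of a node are pairwise distinct, so it suffices that labelling maps
  the children of each permutation bijectively onto the labels prescribed by the succession rule.
\<close>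

section \<open>Generating trees\<close>

text \<open>Replaying the address from the root determines every label on the way, by induction on
  the last step. Hence nodes can be compared by address alone and parents are unique.\<close>

lemma generating_tree_nodes_label_unique:
  assumes "(p, l) \<in> generating_tree_nodes C r" "(p, l') \<in> generating_tree_nodes C r"
  shows "l = l'"
  using assms
proof (induction p arbitrary: l l' rule: rev_induct)
  case Nil
  then show ?case by (auto elim: generating_tree_nodes.cases)
next
  case (snoc k p)
  from snoc.prems(1) obtain a where a: "(p, a) \<in> generating_tree_nodes C r" "l = C a ! k"
    by (auto elim: generating_tree_nodes.cases)
  from snoc.prems(2) obtain b where b: "(p, b) \<in> generating_tree_nodes C r" "l' = C b ! k"
    by (auto elim: generating_tree_nodes.cases)
  show ?case using snoc.IH a b by blast
qed

lemma rooted_tree_generating_tree: "rooted_tree (generating_tree C r)"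
proof -
  let ?N = "generating_tree_nodes C r" and ?E = "arcs (generating_tree C r)"
  have E: "?E = {((p, l), (p @ [k], C l ! k)) | p l k. (p, l) \<in> ?N \<and> k < length (C l)}"
    by (simp add: generating_tree_def)
  have "\<exists>!u. (u, v) \<in> ?E" if v: "v \<in> ?N" "v \<noteq> ([], r)" for v
  proof -
    obtain q m where "v = (q, m)" by (cases v)
    with v obtain p l k where plk: "v = (p @ [k], C l ! k)" "(p, l) \<in> ?N" "k < length (C l)"
      by (blast elim: generating_tree_nodes.cases)
    show ?thesis
    proof
      show "((p, l), v) \<in> ?E" using plk E by auto
      show "u = (p, l)" if "(u, v) \<in> ?E" for u
      proof -
        from that plk(1) obtain l' where "u = (p, l')" "(p, l') \<in> ?N" by (auto simp: E)
        then show ?thesis using generating_tree_nodes_label_unique plk(2) by metis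
      qed
    qed
  qed
  moreover have "(([], r), v) \<in> ?E\<^sup>*" if "v \<in> ?N" for v
  proof -
    obtain p l where v: "v = (p, l)" by (cases v)
    have "(([], r), (p, l)) \<in> ?E\<^sup>*"
      using that unfolding v
    proof (induction rule: generating_tree_nodes.induct)
      case root
      then show ?case by simp
    next
      case (child p l k)
      have "((p, l), (p @ [k], C l ! k)) \<in> ?E" using child.hyps E by auto
      with child.IH show ?case by (rule rtrancl_into_rtrancl)
    qed
    then show ?thesis using v by simp
  qed
  moreover have "?E \<subseteq> ?N \<times> ?N" "\<forall>u. (u, ([], r)) \<notin> ?E"
    by (auto simp: E intro: generating_tree_nodes.child)
  ultimately show ?thesis
    by (auto simp: rooted_tree_def generating_tree_def intro: generating_tree_nodes.root)
qed

text \<open>A bijection between children and prescribed labels at every single node suffices: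
  distinct labels turn each child into a definite position in the list \<open>C (label v)\<close>,
  so addresses can be followed in \<open>T\<close> step by step.\<close>

lemma rooted_tree_isomorphic_generating_tree:
  fixes T :: "'a rooted_digraph" and label :: "'a \<Rightarrow> 'l" and C :: "'l \<Rightarrow> 'l list"
  assumes T: "rooted_tree T"
    and dist: "\<And>v. v \<in> nodes T \<Longrightarrow> distinct (C (label v))"
    and bij: "\<And>v. v \<in> nodes T \<Longrightarrow>
      bij_betw label {u. (v, u) \<in> arcs T} (set (C (label v)))"
  shows "rooted_tree_isomorphic T (generating_tree C (label (root T)))"
proof -
  let ?N = "generating_tree_nodes C (label (root T))"
  let ?G = "generating_tree C (label (root T))"
  \<comment> \<open>The \<open>k\<close>-th child of \<open>v\<close> is the only child that carries
    the \<open>k\<close>-th prescribed label.\<close>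
  define child where
    "child v k = the_inv_into {u. (v, u) \<in> arcs T} label (C (label v) ! k)" for v k
  define node where "node p = foldl child (root T) p" for p
  have node_simps: "node [] = root T" "node (p @ [k]) = child (node p) k" for p k
    by (simp_all add: node_def)
  have label_child: "label (child v k) = C (label v) ! k"
    and child_arc: "(v, child v k) \<in> arcs T"
    if "v \<in> nodes T" "k < length (C (label v))" for v k
  proof -
    have b: "inj_on label {u. (v, u) \<in> arcs T}"
      "C (label v) ! k \<in> label ` {u. (v, u) \<in> arcs T}"
      using bij[OF that(1)] that(2) by (auto simp: bij_betw_def)
    show "label (child v k) = C (label v) ! k"
      unfolding child_def using b by (rule f_the_inv_into_f)
    have "child v k \<in> {u. (v, u) \<in> arcs T}"
      unfolding child_def using b by (rule the_inv_into_into) simp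
    then show "(v, child v k) \<in> arcs T" by simp
  qed
  have arcs_nodes: "v \<in> nodes T" "u \<in> nodes T" if "(v, u) \<in> arcs T" for u v
    using that T by (auto simp: rooted_tree_def)
  have arc_child: "\<exists>k < length (C (label v)). u = child v k" if "(v, u) \<in> arcs T" for u v
  proof -
    have b: "inj_on label {u. (v, u) \<in> arcs T}" "label u \<in> set (C (label v))"
      using bij[OF arcs_nodes(1)[OF that]] that by (auto simp: bij_betw_def)
    then obtain k where k: "k < length (C (label v))" "C (label v) ! k = label u"
      by (auto simp: in_set_conv_nth)
    then have "child v k = u"
      using b that by (simp add: child_def the_inv_into_f_f)
    with k show ?thesis by blast
  qed
  have parent_unique: "u = u'" if "(u, v) \<in> arcs T" "(u', v) \<in> arcs T" for u u' v
    using that T arcs_nodes(2)[OF that(1)] unfolding rooted_tree_def by (metis DiffI singletonD)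
  have node_in: "node p \<in> nodes T \<and> label (node p) = l" if "(p, l) \<in> ?N" for p l
    using that
  proof (induction rule: generating_tree_nodes.induct)
    case root
    then show ?case using T by (simp add: node_simps rooted_tree_def)
  next
    case (child p l k)
    then show ?case
      using label_child[of "node p" k] arcs_nodes(2)[OF child_arc[of "node p" k]]
      by (auto simp: node_simps)
  qed
  \<comment> \<open>Walks are compared from their last step: the root has no incoming arc, so both
    addresses are empty or neither is. In the latter case equal endpoints have equal parents, and
    distinct labels force equal last positions.\<close>
  have node_inj: "p = q"
    if "(p, l) \<in> ?N" "(q, l') \<in> ?N" "node p = node q" for p q l l'
    using that
  proof (induction p arbitrary: q l l' rule: rev_induct)
    case Nil
    show ?case
    proof (cases q rule: rev_cases)
      case (snoc q' k)
      with Nil.prems(2) obtain a where "(q', a) \<in> ?N" "k < length (C a)"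
        by (auto elim: generating_tree_nodes.cases)
      then have "(node q', root T) \<in> arcs T"
        using node_in child_arc snoc Nil.prems(3) by (metis node_simps)
      then show ?thesis using T by (auto simp: rooted_tree_def)
    qed simp
  next
    case (snoc k p)
    from snoc.prems(1) obtain a where a: "(p, a) \<in> ?N" "k < length (C a)"
      by (auto elim: generating_tree_nodes.cases)
    have arc: "(node p, node (p @ [k])) \<in> arcs T"
      using a node_in child_arc by (metis node_simps(2))
    show ?case
    proof (cases q rule: rev_cases)
      case Nil
      then show ?thesis using arc snoc.prems(3) T by (auto simp: rooted_tree_def node_simps)
    next
      case q: (snoc q' k')
      with snoc.prems(2) obtain b where b: "(q', b) \<in> ?N" "k' < length (C b)"
        by (auto elim: generating_tree_nodes.cases)
      have "(node q', node (p @ [k])) \<in> arcs T"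
        using b node_in child_arc q snoc.prems(3) by (metis node_simps(2))
      then have nn: "node p = node q'" using arc parent_unique by blast
      then have pq: "p = q'" using snoc.IH a b by blast
      have "child (node p) k = child (node p) k'"
        using snoc.prems(3) q pq by (simp add: node_simps)
      then have "C a ! k = C a ! k'"
        using label_child a b node_in nn by metis
      moreover have "a = b" using a b pq generating_tree_nodes_label_unique by metis
      moreover have "distinct (C a)" using dist node_in a by metis
      ultimately have "k = k'" using a b by (simp add: nth_eq_iff_index_eq)
      with pq q show ?thesis by simp
    qed
  qed
  \<comment> \<open>Reachability from the root in \<open>T\<close> supplies the address, one arc at
    a time.\<close>
  have node_surj: "\<exists>p l. (p, l) \<in> ?N \<and> node p = v" if "v \<in> nodes T" for v
  proof -
    have "(root T, v) \<in> (arcs T)\<^sup>*" using T that by (simp add: rooted_tree_def)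
    then show ?thesis
    proof (induction rule: rtrancl_induct)
      case base
      then show ?case using generating_tree_nodes.root node_simps(1) by metis
    next
      case (step u v)
      then obtain p l where p: "(p, l) \<in> ?N" "node p = u" by blast
      from arc_child[OF step(2)] obtain k where "k < length (C (label u))" "v = child u k"
        by blast
      then show ?case
        using generating_tree_nodes.child[OF p(1)] node_in[OF p(1)] p(2) node_simps(2) by metis
    qed
  qed
  define g where "g = (\<lambda>a :: nat list \<times> 'l. node (fst a))"
  have bij_g: "bij_betw g ?N (nodes T)"
    unfolding bij_betw_def
  proof
    show "inj_on g ?N"
      using node_inj node_in by (auto simp: inj_on_def g_def) blast+
    show "g ` ?N = nodes T"
      using node_in node_surj by (force simp: g_def image_iff)
  qed
  have arcs_g: "(g a, g b) \<in> arcs T \<longleftrightarrow> (a, b) \<in> arcs ?G" if "a \<in> ?N" "b \<in> ?N" for a b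
  proof -
    obtain p l q l' where ab: "a = (p, l)" "b = (q, l')" by (cases a, cases b)
    have p: "node p \<in> nodes T" "label (node p) = l" using node_in that ab by auto
    show ?thesis
    proof
      assume "(g a, g b) \<in> arcs T"
      then obtain k where k: "k < length (C l)" "node q = node (p @ [k])"
        using arc_child p ab by (force simp: g_def node_simps)
      have c: "(p @ [k], C l ! k) \<in> ?N"
        using that ab k by (auto intro: generating_tree_nodes.child)
      then have "q = p @ [k]" using node_inj that ab k by blast
      moreover then have "l' = C l ! k"
        using c that ab generating_tree_nodes_label_unique by metis
      ultimately show "(a, b) \<in> arcs ?G"
        using that ab k by (auto simp: generating_tree_def)
    next
      assume "(a, b) \<in> arcs ?G"
      then obtain k where "q = p @ [k]" "k < length (C l)"
        using ab by (auto simp: generating_tree_def)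
      then show "(g a, g b) \<in> arcs T"
        using child_arc p ab by (auto simp: g_def node_simps)
    qed
  qed
  \<comment> \<open>The walk \<open>g\<close> runs from the generating tree to \<open>T\<close>, so
    the required isomorphism is its inverse.\<close>
  let ?f = "the_inv_into ?N g"
  have gf: "g (?f u) = u" and fN: "?f u \<in> ?N" if "u \<in> nodes T" for u
    using that bij_g
    by (auto simp: bij_betw_def intro: f_the_inv_into_f the_inv_into_into[OF _ _ subset_refl])
  have root: "?f (root T) = ([], label (root T))"
    using the_inv_into_f_f[OF bij_betw_imp_inj_on[OF bij_g] generating_tree_nodes.root]
    by (simp add: g_def node_simps)
  have "rooted_tree_isomorphic T ?G"
    unfolding rooted_tree_isomorphic_def
  proof (intro conjI T rooted_tree_generating_tree exI[of _ ?f] ballI)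
    show "bij_betw ?f (nodes T) (nodes ?G)"
      using bij_betw_the_inv_into[OF bij_g] by (simp add: generating_tree_def)
    show "?f (root T) = root ?G" using root by (simp add: generating_tree_def)
    show "(u, v) \<in> arcs T \<longleftrightarrow> (?f u, ?f v) \<in> arcs ?G"
      if "u \<in> nodes T" "v \<in> nodes T" for u v
      using arcs_g[OF fN[OF that(1)] fN[OF that(2)]] gf that by simp
  qed
  then show ?thesis .
qed

section \<open>Pattern avoidance\<close>

text \<open>
  Both forbidden patterns in one predicate that is invariant under reversal and complement;
  \<open>b\<close> and \<open>c\<close> are the two adjacent entries.
\<close>

definition vincular_pattern :: "nat \<Rightarrow> nat \<Rightarrow> nat \<Rightarrow> nat \<Rightarrow> bool" where
  "vincular_pattern x b c y \<longleftrightarrow> b < y \<and> y < x \<and> x < c \<or> c < x \<and> x < y \<and> y < b"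

definition avoids :: "nat list \<Rightarrow> bool" where
  "avoids w \<longleftrightarrow> (\<forall>ps b c qs. w = ps @ b # c # qs \<longrightarrow>
     (\<forall>x \<in> set ps. \<forall>y \<in> set qs. \<not> vincular_pattern x b c y))"

lemma avoidsI:
  assumes "\<And>ps b c qs x y. w = ps @ b # c # qs \<Longrightarrow> x \<in> set ps \<Longrightarrow> y \<in> set qs \<Longrightarrow>
    vincular_pattern x b c y \<Longrightarrow> False"
  shows "avoids w"
  using assms unfolding avoids_def by blast

lemma avoidsD:
  "avoids (ps @ b # c # qs) \<Longrightarrow> x \<in> set ps \<Longrightarrow> y \<in> set qs \<Longrightarrow> \<not> vincular_pattern x b c y"
  unfolding avoids_def by blast

text \<open>Links the index form of the definition of \<open>baxter\<close> to list decompositions,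
  which suit insertion and deletion.\<close>

lemma avoids_iff_nth:
  "avoids w \<longleftrightarrow> \<not> (\<exists>i j k. i < j \<and> j + 1 < k \<and> k < length w \<and>
     vincular_pattern (w ! i) (w ! j) (w ! (j + 1)) (w ! k))"
proof
  assume w: "avoids w"
  show "\<not> (\<exists>i j k. i < j \<and> j + 1 < k \<and> k < length w \<and>
     vincular_pattern (w ! i) (w ! j) (w ! (j + 1)) (w ! k))"
  proof clarify
    fix i j k
    assume *: "i < j" "j + 1 < k" "k < length w"
      "vincular_pattern (w ! i) (w ! j) (w ! (j + 1)) (w ! k)"
    have "w = take j w @ w ! j # w ! (j + 1) # drop (j + 2) w"
      using * by (metis Cons_nth_drop_Suc Suc_eq_plus1 Suc_lessD add_2_eq_Suc' append_take_drop_id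
          less_trans)
    moreover have "w ! i \<in> set (take j w)"
      using * by (auto simp: in_set_conv_nth intro!: exI[of _ i])
    moreover obtain d where "k = j + 2 + d" using * le_Suc_ex[of "j + 2" k] by auto
    then have "w ! k \<in> set (drop (j + 2) w)"
      using * nth_mem[of d "drop (j + 2) w"] by simp
    ultimately show False using w * avoidsD by metis
  qed
next
  assume n: "\<not> (\<exists>i j k. i < j \<and> j + 1 < k \<and> k < length w \<and>
     vincular_pattern (w ! i) (w ! j) (w ! (j + 1)) (w ! k))"
  show "avoids w"
  proof (rule avoidsI)
    fix ps b c qs x y
    assume *: "w = ps @ b # c # qs" "x \<in> set ps" "y \<in> set qs" "vincular_pattern x b c y"
    obtain i where i: "i < length ps" "ps ! i = x" using * by (auto simp: in_set_conv_nth)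
    obtain k where k: "k < length qs" "qs ! k = y" using * by (auto simp: in_set_conv_nth)
    have "w ! i = x" "w ! length ps = b" "w ! (length ps + 1) = c" "w ! (length ps + 2 + k) = y"
      using i k * by (auto simp: nth_append)
    moreover have "length ps + 2 + k < length w" using * k by simp
    ultimately show False using n i *(4)
      by (metis add.commute add_less_mono1 less_add_same_cancel2 nat_1_add_1
          one_less_numeral_iff semiring_norm(76) trans_less_add1)
  qed
qed

lemma baxter_iff: "baxter w \<longleftrightarrow> is_permutation w \<and> avoids w"
  unfolding baxter_def avoids_iff_nth vincular_pattern_def by blast

lemma avoids_short: "length w < 4 \<Longrightarrow> avoids w"
proof (rule avoidsI)
  fix ps b c qs x y
  assume "length w < 4" "w = ps @ b # c # qs" "x \<in> set ps" "y \<in> set qs"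
  then show False by (cases ps; cases qs) auto
qed

text \<open>Reversal exchanges \<open>x\<close> with \<open>y\<close> and \<open>b\<close> with
  \<open>c\<close>, which swaps the two disjuncts of \<open>vincular_pattern\<close>.\<close>

lemma avoids_rev: "avoids (rev w) \<longleftrightarrow> avoids w"
proof -
  have "avoids (rev w)" if "avoids w" for w
  proof (rule avoidsI)
    fix ps b c qs x y
    assume *: "rev w = ps @ b # c # qs" "x \<in> set ps" "y \<in> set qs" "vincular_pattern x b c y"
    from *(1) have "w = rev qs @ c # b # rev ps"
      by (metis append.assoc append_Cons append_Nil rev.simps(2) rev_append rev_rev_ident)
    then show False using avoidsD[of "rev qs" c b "rev ps" y x] that *
      by (auto simp: vincular_pattern_def)
  qed
  then show ?thesis by (metis rev_rev_ident)
qed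

lemma avoids_map:
  assumes "avoids w"
    and "\<And>x b c y. {x, b, c, y} \<subseteq> set w \<Longrightarrow> vincular_pattern (f x) (f b) (f c) (f y) \<Longrightarrow>
      vincular_pattern x b c y"
  shows "avoids (map f w)"
proof (rule avoidsI)
  fix ps b c qs x y
  assume *: "map f w = ps @ b # c # qs" "x \<in> set ps" "y \<in> set qs" "vincular_pattern x b c y"
  then obtain ps' b' c' qs' where w: "w = ps' @ b' # c' # qs'" "ps = map f ps'" "b = f b'"
    "c = f c'" "qs = map f qs'"
    by (auto simp: map_eq_append_conv map_eq_Cons_conv)
  with * obtain x' y' where "x' \<in> set ps'" "y' \<in> set qs'" "x = f x'" "y = f y'" by auto
  then show False using * w assms avoidsD[of ps' b' c' qs' x' y'] by auto
qed

lemma avoids_map_Suc: "avoids (map Suc w) \<longleftrightarrow> avoids w"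
proof
  assume "avoids (map Suc w)"
  then have "avoids (map (\<lambda>x. x - 1) (map Suc w))"
    by (rule avoids_map) (auto simp: vincular_pattern_def)
  then show "avoids w" by (simp add: o_def)
qed (rule avoids_map, auto simp: vincular_pattern_def)

text \<open>Complementing reverses the order of values, so each of the two patterns becomes the
  other.\<close>

lemma avoids_complement:
  assumes "avoids w" "\<And>x. x \<in> set w \<Longrightarrow> x \<le> N"
  shows "avoids (map (\<lambda>x. N - x) w)"
  using assms(1) by (rule avoids_map) (auto simp: vincular_pattern_def dest!: assms(2))

section \<open>Deleting and inserting a maximum\<close>

definition insertion_site :: "nat list \<Rightarrow> nat list \<Rightarrow> bool" where
  "insertion_site xs ys \<longleftrightarrow>
     (ys \<noteq> [] \<and> (\<forall>x \<in> set xs. x < hd ys)) \<or> (xs \<noteq> [] \<and> (\<forall>y \<in> set ys. y < last xs))"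

text \<open>Deletion creates only one new adjacency \<open>b\<close>, \<open>c\<close>. A pattern
  using it yields one through \<open>M\<close>: with \<open>b\<close> and \<open>M\<close> adjacent
  in the case 3-14-2, with \<open>M\<close> and \<open>c\<close> adjacent in the case
  2-41-3.\<close>

lemma avoids_remove_max:
  assumes av: "avoids (xs @ M # ys)" and M: "\<And>x. x \<in> set (xs @ ys) \<Longrightarrow> x < M"
  shows "avoids (xs @ ys)"
proof (rule avoidsI)
  fix ps b c qs x y
  assume *: "xs @ ys = ps @ b # c # qs" "x \<in> set ps" "y \<in> set qs" "vincular_pattern x b c y"
  from *(1) consider zs where "ps = xs @ zs" "ys = zs @ b # c # qs"
    | "xs = ps @ [b]" "ys = c # qs"
    | zs where "xs = ps @ b # c # zs" "qs = zs @ ys"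
    by (auto simp: append_eq_append_conv2 append_eq_Cons_conv Cons_eq_append_conv)
  then show False
  proof cases
    case 1
    then show False
      using av * avoidsD[of "xs @ M # zs" b c qs x y] by auto
  next
    case 2
    then have "\<not> vincular_pattern x b M y" "\<not> vincular_pattern x M c y"
      using av * avoidsD[of ps b M "c # qs" x y] avoidsD[of "ps @ [b]" M c qs x y] by auto
    then show False using M 2 * by (auto simp: vincular_pattern_def)
  next
    case 3
    then show False
      using av * avoidsD[of ps b c "zs @ M # ys" x y] by auto
  qed
qed

text \<open>If the slot between \<open>b\<close> and \<open>c\<close> is neither just before a
  left-to-right maximum nor just after a right-to-left maximum, some earlier \<open>x\<close>
  exceeds \<open>c\<close> and some later \<open>y\<close> exceeds \<open>b\<close>. Then
  \<open>x M c y\<close> is a 2-41-3 if \<open>x < y\<close>, and \<open>x b M y\<close> is a 3-14-2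
  if \<open>y < x\<close>.\<close>

lemma avoids_insert_max_site:
  assumes av: "avoids (xs @ M # ys)" and M: "\<And>x. x \<in> set (xs @ ys) \<Longrightarrow> x < M"
    and dist: "distinct (xs @ ys)" and ne: "xs @ ys \<noteq> []"
  shows "insertion_site xs ys"
proof (rule ccontr)
  assume n: "\<not> insertion_site xs ys"
  then have "xs \<noteq> []" "ys \<noteq> []" using ne by (auto simp: insertion_site_def)
  then obtain xs' b c ys' where s: "xs = xs' @ [b]" "ys = c # ys'"
    by (metis append_butlast_last_id list.exhaust)
  from n s dist obtain x y where xy: "x \<in> set xs" "c < x" "y \<in> set ys" "b < y"
    by (auto simp: insertion_site_def not_less dest: le_neq_implies_less)
  have "x \<noteq> y" using dist xy by auto
  then consider "x < y" | "y < x" by linarith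
  then show False
  proof cases
    case 1
    then have "y \<in> set ys'" using xy s by auto
    then show False
      using avoidsD[of xs M c ys' x y] av xy s 1 M by (auto simp: vincular_pattern_def)
  next
    case 2
    then have "x \<in> set xs'" using xy s by auto
    then show False
      using avoidsD[of xs' b M ys x y] av xy s 2 M by (auto simp: vincular_pattern_def)
  qed
qed

text \<open>The outer entries of a pattern are never its largest, so \<open>M\<close> could only be
  one of the two adjacent entries. As the left one it would need the next entry to be below some
  earlier \<open>x\<close>, against \<open>site\<close>; as the right one it can be replaced by
  \<open>hd ys\<close>.\<close>

lemma avoids_insert_max:
  assumes av: "avoids (xs @ ys)" and M: "\<And>x. x \<in> set (xs @ ys) \<Longrightarrow> x < M"
    and site: "ys \<noteq> []" "\<And>x. x \<in> set xs \<Longrightarrow> x < hd ys"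
  shows "avoids (xs @ M # ys)"
proof (rule avoidsI)
  fix ps b c qs x y
  assume *: "xs @ M # ys = ps @ b # c # qs" "x \<in> set ps" "y \<in> set qs" "vincular_pattern x b c y"
  from *(1) consider zs where "ps = xs @ M # zs" "ys = zs @ b # c # qs"
    | "ps = xs" "b = M" "ys = c # qs"
    | "xs = ps @ [b]" "c = M" "ys = qs"
    | zs where "xs = ps @ b # c # zs" "qs = zs @ M # ys"
    by (auto simp: append_eq_append_conv2 append_eq_Cons_conv Cons_eq_append_conv)
  then show False
  proof cases
    case 1
    have "b < M" "c < M" "y < M" using 1 * M by auto
    then have "x \<noteq> M" using *(4) by (auto simp: vincular_pattern_def)
    then show False
      using av * avoidsD[of "xs @ zs" b c qs x y] 1 by auto
  next
    case 2
    then have "x < c" using site * by auto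
    moreover have "y < M" using * M 2 by auto
    ultimately show False using * 2 by (auto simp: vincular_pattern_def)
  next
    case 3
    obtain d ds where ys: "ys = d # ds" using site by (cases ys) auto
    have "x < d" "b < d" using site ys 3 * by auto
    moreover have "x < M" using * 3 M by auto
    then have "b < y" "y < x" using * 3 by (auto simp: vincular_pattern_def)
    \<comment> \<open>\<open>y < x < d\<close> rules out \<open>y = d\<close>, so \<open>y\<close>
      lies beyond the pair \<open>b\<close>, \<open>d\<close>.\<close>
    moreover then have "y \<in> set ds" using * 3 ys \<open>x < d\<close> by auto
    ultimately show False
      using avoidsD[of ps b d ds x y] av * 3 ys by (auto simp: vincular_pattern_def)
  next
    case 4
    have "b < M" "c < M" "x < M" using 4 * M by auto
    then have "y \<noteq> M" using *(4) by (auto simp: vincular_pattern_def)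
    then show False
      using av * avoidsD[of ps b c "zs @ ys" x y] 4 by auto
  qed
qed

section \<open>Inserting next to a given entry\<close>

text \<open>The place is given by a neighbouring value instead of an index, so that insertion
  behaves well under append, reversal and injective maps, and hence under rotation.\<close>

primrec insert_before :: "'a \<Rightarrow> 'a \<Rightarrow> 'a list \<Rightarrow> 'a list" where
  "insert_before a x [] = []"
| "insert_before a x (y # ys) = (if y = x then [a, y] else [y]) @ insert_before a x ys"

primrec insert_after :: "'a \<Rightarrow> 'a \<Rightarrow> 'a list \<Rightarrow> 'a list" where
  "insert_after a x [] = []"
| "insert_after a x (y # ys) = (if y = x then [y, a] else [y]) @ insert_after a x ys"

lemma insert_before_append:
  "insert_before a x (xs @ ys) = insert_before a x xs @ insert_before a x ys"
  by (induction xs) auto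

lemma insert_after_append:
  "insert_after a x (xs @ ys) = insert_after a x xs @ insert_after a x ys"
  by (induction xs) auto

lemma insert_before_notin: "x \<notin> set l \<Longrightarrow> insert_before a x l = l"
  by (induction l) auto

lemma insert_after_notin: "x \<notin> set l \<Longrightarrow> insert_after a x l = l"
  by (induction l) auto

lemma insert_after_Cons_eq: "\<exists>ds. insert_after a y (x # xs) = x # ds"
  by (cases "x = y") auto

lemma set_insert_before_subset: "set (insert_before a x l) \<subseteq> insert a (set l)"
  by (induction l) auto

lemma set_insert_after_subset: "set (insert_after a x l) \<subseteq> insert a (set l)"
  by (induction l) auto

lemma rev_insert_before: "rev (insert_before a x l) = insert_after a x (rev l)"
  by (induction l) (auto simp: insert_after_append)

lemma rev_insert_after: "rev (insert_after a x l) = insert_before a x (rev l)"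
  by (induction l) (auto simp: insert_before_append)

lemma map_insert_before:
  "(\<And>y. y \<in> set l \<Longrightarrow> f y = f x \<Longrightarrow> y = x) \<Longrightarrow>
    map f (insert_before a x l) = insert_before (f a) (f x) (map f l)"
  by (induction l) auto

lemma map_insert_after:
  "(\<And>y. y \<in> set l \<Longrightarrow> f y = f x \<Longrightarrow> y = x) \<Longrightarrow>
    map f (insert_after a x l) = insert_after (f a) (f x) (map f l)"
  by (induction l) auto

text \<open>The hypotheses prevent a freshly inserted entry from triggering the other insertion. If
  \<open>x\<close> directly follows \<open>y\<close>, both orders give
  \<open>y, b, a, x\<close>.\<close>

lemma insert_before_after_commute:
  "a \<noteq> y \<Longrightarrow> b \<noteq> x \<Longrightarrow>
    insert_before a x (insert_after b y l) = insert_after b y (insert_before a x l)"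
  by (induction l) auto

lemma filter_neq_notin: "a \<notin> set l \<Longrightarrow> filter (\<lambda>z. z \<noteq> a) l = l"
  by (induction l) auto

lemma insert_before_filter:
  assumes "w = cs @ a # x # ds" "distinct w"
  shows "insert_before a x (filter (\<lambda>z. z \<noteq> a) w) = w"
  using assms by (auto simp: insert_before_append insert_before_notin filter_neq_notin)

lemma insert_after_filter:
  assumes "w = cs @ x # a # ds" "distinct w"
  shows "insert_after a x (filter (\<lambda>z. z \<noteq> a) w) = w"
  using assms by (auto simp: insert_after_append insert_after_notin filter_neq_notin)

section \<open>Rotation\<close>

text \<open>Reverse-complement. \<open>N\<close> is a parameter because the same constant must serve
  a child, its shifted parent and the list with only one new entry, whose lengths differ.\<close>

definition rot :: "nat \<Rightarrow> nat list \<Rightarrow> nat list" where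
  "rot N w = map (\<lambda>x. N - x) (rev w)"

lemma rot_append: "rot N (xs @ ys) = rot N ys @ rot N xs"
  by (simp add: rot_def)

lemma rot_Cons: "rot N (x # xs) = rot N xs @ [N - x]"
  by (simp add: rot_def)

lemma rot_Nil_iff: "rot N w = [] \<longleftrightarrow> w = []"
  by (simp add: rot_def)

lemma rotation_fixed_iff: "rotation_fixed w \<longleftrightarrow> rot (length w + 1) w = w"
proof -
  have "rot (length w + 1) w = w \<longleftrightarrow>
      (\<forall>i < length w. length w + 1 - w ! (length w - 1 - i) = w ! i)"
    by (simp add: rot_def list_eq_iff_nth_eq rev_nth)
  also have "\<dots> \<longleftrightarrow> rotation_fixed w" (is "?L \<longleftrightarrow> _")
  proof
    assume L: ?L
    show "rotation_fixed w"
      unfolding rotation_fixed_def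
    proof (intro allI impI)
      fix i assume "i < length w"
      then show "w ! (length w - 1 - i) = length w + 1 - w ! i"
        \<comment> \<open>The two forms of the equation are read off at mirrored positions.\<close>
        using L[rule_format, of "length w - 1 - i"] by simp
    qed
  next
    assume R: "rotation_fixed w"
    show ?L
    proof (intro allI impI)
      fix i assume "i < length w"
      then show "length w + 1 - w ! (length w - 1 - i) = w ! i"
        using R[unfolded rotation_fixed_def, rule_format, of "length w - 1 - i"] by simp
    qed
  qed
  finally show ?thesis by simp
qed

lemma avoids_rot: "avoids w \<Longrightarrow> (\<And>x. x \<in> set w \<Longrightarrow> x \<le> N) \<Longrightarrow> avoids (rot N w)"
  unfolding rot_def by (rule avoids_complement) (auto simp: avoids_rev)

section \<open>Left-to-right maxima\<close>

text \<open>Maxima are recorded by value; right-to-left maxima are obtained as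
  \<open>lr_maxima (rev w)\<close>.\<close>

definition lr_maxima :: "nat list \<Rightarrow> nat set" where
  "lr_maxima w = {x. \<exists>ps qs. w = ps @ x # qs \<and> (\<forall>y \<in> set ps. y < x)}"

lemma lr_maxima_Nil [simp]: "lr_maxima [] = {}"
  by (simp add: lr_maxima_def)

lemma lr_maxima_Cons: "lr_maxima (x # xs) = insert x {y \<in> lr_maxima xs. x < y}"
proof (intro set_eqI iffI)
  fix y assume "y \<in> lr_maxima (x # xs)"
  then obtain ps qs where y: "x # xs = ps @ y # qs" "\<forall>z \<in> set ps. z < y"
    by (auto simp: lr_maxima_def)
  then show "y \<in> insert x {y \<in> lr_maxima xs. x < y}"
    by (cases ps) (auto simp: lr_maxima_def)
next
  fix y assume "y \<in> insert x {y \<in> lr_maxima xs. x < y}"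
  then consider "y = x" | ps qs where "xs = ps @ y # qs" "\<forall>z \<in> set ps. z < y" "x < y"
    by (auto simp: lr_maxima_def)
  then show "y \<in> lr_maxima (x # xs)"
  proof cases
    case 1
    then have "x # xs = [] @ y # xs \<and> (\<forall>z \<in> set []. z < y)" by simp
    then show ?thesis unfolding lr_maxima_def by blast
  next
    case 2
    then have "x # xs = (x # ps) @ y # qs \<and> (\<forall>z \<in> set (x # ps). z < y)" by simp
    then show ?thesis unfolding lr_maxima_def by blast
  qed
qed

lemma lr_maxima_append:
  "lr_maxima (xs @ ys) = lr_maxima xs \<union> {y \<in> lr_maxima ys. \<forall>x \<in> set xs. x < y}"
  by (induction xs) (auto simp: lr_maxima_Cons)

lemma lr_maxima_subset: "lr_maxima w \<subseteq> set w"
  by (auto simp: lr_maxima_def)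

lemma finite_lr_maxima: "finite (lr_maxima w)"
  using lr_maxima_subset finite_set by (rule finite_subset)

lemma lr_maxima_eq_empty: "lr_maxima w = {} \<longleftrightarrow> w = []"
  by (cases w) (auto simp: lr_maxima_Cons)

lemma lr_maxima_map_Suc: "lr_maxima (map Suc w) = Suc ` lr_maxima w"
  by (induction w) (auto simp: lr_maxima_Cons)

text \<open>A larger entry stands before \<open>m\<close>, so \<open>m\<close> is no maximum itself
  and hides no later one.\<close>

lemma lr_maxima_insert_small:
  assumes "xs \<noteq> []" "\<And>x. x \<in> set xs \<Longrightarrow> m < x"
  shows "lr_maxima (xs @ m # ys) = lr_maxima (xs @ ys)"
proof -
  obtain x where "x \<in> set xs" using assms(1) by (cases xs) auto
  with assms(2)[OF this] show ?thesis
    by (auto simp: lr_maxima_append lr_maxima_Cons)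
qed

lemma lr_maxima_Cons_min:
  assumes "\<And>z. z \<in> set ys \<Longrightarrow> m < z"
  shows "lr_maxima (m # ys) = insert m (lr_maxima ys)"
  using assms subsetD[OF lr_maxima_subset[of ys]] by (auto simp: lr_maxima_Cons)

lemma lr_maxima_insert_max:
  assumes "\<And>z. z \<in> set (xs @ ys) \<Longrightarrow> z < M"
  shows "lr_maxima (xs @ M # ys) = insert M (lr_maxima xs)"
proof -
  have "lr_maxima (M # ys) = {M}"
    using assms subsetD[OF lr_maxima_subset[of ys]] by (fastforce simp: lr_maxima_Cons)
  then show ?thesis using assms by (auto simp: lr_maxima_append)
qed

lemma lr_maxima_append_small:
  assumes "\<And>z. z \<in> set ys \<Longrightarrow> \<exists>x \<in> set xs. z < x"
  shows "lr_maxima (xs @ ys) = lr_maxima xs"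
proof -
  have "\<not> (\<forall>x \<in> set xs. x < z)" if "z \<in> lr_maxima ys" for z
    using assms[of z] subsetD[OF lr_maxima_subset that] less_asym by blast
  then show ?thesis by (auto simp: lr_maxima_append)
qed

text \<open>Left-to-right maxima increase along the list, so those below the maximum
  \<open>x\<close> are exactly those preceding it.\<close>

lemma lr_maxima_append_Cons_max:
  assumes "\<And>z. z \<in> set xs \<Longrightarrow> z < x"
  shows "{z \<in> lr_maxima (xs @ x # ys). z < x} = lr_maxima xs"
  using assms subsetD[OF lr_maxima_subset[of xs]]
  by (auto simp: lr_maxima_append lr_maxima_Cons)

definition label :: "nat list \<Rightarrow> nat \<times> nat" where
  "label w = (card (lr_maxima w), card (lr_maxima (rev w)))"

section \<open>Symmetric Baxter permutations and their parents\<close>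

definition symmetric_baxter :: "nat list set" where
  "symmetric_baxter = {w. baxter w \<and> rotation_fixed w}"

lemma symmetric_baxter_iff:
  "w \<in> symmetric_baxter \<longleftrightarrow>
     distinct w \<and> set w = {1..length w} \<and> avoids w \<and> rot (length w + 1) w = w"
  by (auto simp: symmetric_baxter_def baxter_iff is_permutation_def permutations_of_set_def
      rotation_fixed_iff)

text \<open>After the shift a parent is literally a sublist of its child, with entries
  \<open>2\<close> to \<open>length w + 1\<close>, and the rotation constant
  \<open>length w + 3\<close> is that of the child.\<close>

lemma symmetric_baxter_map_Suc_iff:
  "w \<in> symmetric_baxter \<longleftrightarrow> distinct (map Suc w) \<and> set (map Suc w) = {2..length w + 1} \<and>
     avoids (map Suc w) \<and> rot (length w + 3) (map Suc w) = map Suc w"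
proof -
  have "{2..length w + 1} = Suc ` {1..length w}" by (simp add: image_Suc_atLeastAtMost numeral_2_eq_2)
  then have s: "set (map Suc w) = {2..length w + 1} \<longleftrightarrow> set w = {1..length w}"
    by (simp add: inj_image_eq_iff del: image_Suc_atLeastAtMost)
  have r: "rot (length w + 3) (map Suc w) = map Suc (rot (length w + 1) w)"
    if "set w = {1..length w}"
  proof -
    have "length w + 3 - Suc x = Suc (length w + 1 - x)" if "x \<in> set w" for x
      using \<open>set w = {1..length w}\<close> that by auto
    then show ?thesis by (simp add: rot_def rev_map)
  qed
  have "inj (map Suc)" by simp
  then have "map Suc (rot (length w + 1) w) = map Suc w \<longleftrightarrow> rot (length w + 1) w = w"
    by (metis injD)
  then show ?thesis
    unfolding symmetric_baxter_iff s avoids_map_Suc using r by (auto simp: distinct_map)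
qed

lemma rot_rev: "rot N (rev w) = rev (rot N w)"
  by (simp add: rot_def rev_map)

text \<open>Reversal lets insertions next to right-to-left maxima be deduced from those next to
  left-to-right maxima.\<close>

lemma rev_symmetric_baxter: "w \<in> symmetric_baxter \<Longrightarrow> rev w \<in> symmetric_baxter"
  by (auto simp: symmetric_baxter_iff avoids_rev rot_rev)

lemma label_rev: "label (rev w) = prod.swap (label w)"
  by (simp add: label_def)

lemma delete_extremes_rev: "delete_extremes (rev w) = rev (delete_extremes w)"
  by (simp add: delete_extremes_def rev_map rev_filter)

lemma map_Suc_delete_extremes:
  assumes "set w = {1..length w}"
  shows "map Suc (delete_extremes w) = filter (\<lambda>x. x \<noteq> length w \<and> x \<noteq> 1) w"
  unfolding delete_extremes_def map_map
  by (rule map_idI) (use assms in auto)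

lemma avoids_filter_max:
  assumes "avoids w" "distinct w" "\<And>x. x \<in> set w \<Longrightarrow> x \<le> M"
  shows "avoids (filter (\<lambda>x. x \<noteq> M) w)"
proof (cases "M \<in> set w")
  case True
  then obtain xs ys where w: "w = xs @ M # ys" by (auto simp: in_set_conv_decomp)
  have "x < M" if "x \<in> set (xs @ ys)" for x
    using assms(2) assms(3)[of x] that w by (auto intro: le_neq_implies_less)
  then have "avoids (xs @ ys)" using avoids_remove_max assms(1) w by blast
  moreover have "filter (\<lambda>x. x \<noteq> M) w = xs @ ys"
    using assms(2) w by (auto simp: filter_neq_notin)
  ultimately show ?thesis by simp
next
  case False
  then have "filter (\<lambda>x. x \<noteq> M) w = w" by (auto simp: filter_neq_notin)
  with assms(1) show ?thesis by simp
qed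

text \<open>Deleting the minimum amounts to deleting the maximum of the complement.\<close>

lemma avoids_filter_min:
  assumes "avoids w" "distinct w" "\<And>x. x \<in> set w \<Longrightarrow> m \<le> x"
  shows "avoids (filter (\<lambda>x. x \<noteq> m) w)"
proof -
  \<comment> \<open>Including \<open>m\<close> keeps the set nonempty and gives
    \<open>m \<le> N\<close> even for empty \<open>w\<close>; complementing by \<open>N\<close> is
    then an involution on the entries.\<close>
  define N where "N = Max (insert m (set w))"
  have N: "x \<le> N" if "x \<in> set w" for x using that by (simp add: N_def)
  have mN: "m \<le> N" by (simp add: N_def)
  let ?c = "map (\<lambda>x. N - x)"
  have "avoids (?c w)" using assms(1) N by (rule avoids_complement)
  moreover have "distinct (?c w)"
    using assms(2) N by (auto simp: distinct_map inj_on_def dest!: N)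
  moreover have "y \<le> N - m" if "y \<in> set (?c w)" for y
    using that assms(3) by (auto intro: diff_le_mono2)
  ultimately have "avoids (filter (\<lambda>y. y \<noteq> N - m) (?c w))" by (rule avoids_filter_max)
  also have "filter (\<lambda>y. y \<noteq> N - m) (?c w) = ?c (filter (\<lambda>x. x \<noteq> m) w)"
    using mN by (auto simp: filter_map o_def intro!: arg_cong[of _ _ ?c] filter_cong dest!: N)
  finally have "avoids (?c (?c (filter (\<lambda>x. x \<noteq> m) w)))" by (rule avoids_complement) auto
  moreover have "?c (?c (filter (\<lambda>x. x \<noteq> m) w)) = filter (\<lambda>x. x \<noteq> m) w"
    unfolding map_map by (rule map_idI) (auto dest!: N)
  ultimately show ?thesis by simp
qed

lemma delete_extremes_symmetric_baxter:
  assumes "w \<in> symmetric_baxter" "length w \<ge> 2"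
  shows "delete_extremes w \<in> symmetric_baxter" and "length (delete_extremes w) + 2 = length w"
proof -
  let ?M = "length w" and ?P = "\<lambda>x. x \<noteq> length w \<and> x \<noteq> 1"
  let ?v = "filter ?P w"
  have w: "distinct w" "set w = {1..?M}" "avoids w" "rot (?M + 1) w = w"
    using assms(1) by (auto simp: symmetric_baxter_iff)
  have v: "map Suc (delete_extremes w) = ?v" using w(2) by (rule map_Suc_delete_extremes)
  have sv: "set ?v = {2..?M - 1}" using w(2) assms(2) by auto
  have dv: "distinct ?v" using w(1) by simp
  have "length ?v = ?M - 2" using distinct_card[OF dv] sv assms(2) by simp
  then have "length (delete_extremes w) = ?M - 2" using v by (metis length_map)
  then show len: "length (delete_extremes w) + 2 = length w" using assms(2) by simp
  have "avoids (filter (\<lambda>x. x \<noteq> 1) (filter (\<lambda>x. x \<noteq> ?M) w))"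
    using w by (intro avoids_filter_min avoids_filter_max) auto
  then have av: "avoids ?v" by (simp add: conj_commute)
  \<comment> \<open>Complementing exchanges the two deleted values \<open>1\<close> and
    \<open>?M\<close>, so \<open>?P\<close> is invariant.\<close>
  have "rot (?M + 1) ?v = filter ?P (rot (?M + 1) w)"
    unfolding rot_def filter_map rev_filter
    by (rule arg_cong[of _ _ "map _"], rule filter_cong) (use w(2) assms(2) in auto)
  then have rv: "rot (?M + 1) ?v = ?v" using w(4) by simp
  have l: "length (delete_extremes w) + 3 = ?M + 1" "length (delete_extremes w) + 1 = ?M - 1"
    using len by auto
  show "delete_extremes w \<in> symmetric_baxter"
    unfolding symmetric_baxter_map_Suc_iff v l using dv sv av rv by (intro conjI)
qed

section \<open>Children\<close>

text \<open>
  When the two new entries fall into the same (central) slot, placing them relative to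
  \<open>x\<close> and its rotated image fixes their order, the other order being non-Baxter.
\<close>

definition lr_child :: "nat list \<Rightarrow> nat \<Rightarrow> nat list" where
  "lr_child w x = insert_before (length w + 2) x
     (insert_after 1 (length w + 3 - x) (map Suc w))"

text \<open>Gives two views of the list with only the new \<open>1\<close>: around \<open>x\<close>,
  where the new maximum enters, and around the rotated image of \<open>x\<close>, behind which
  \<open>1\<close> stands. The second comes from rotating the split of \<open>map Suc w\<close> at
  \<open>x\<close>.\<close>

lemma lr_child_split:
  assumes w: "w \<in> symmetric_baxter" and x: "x \<in> lr_maxima (map Suc w)"
  obtains ps qs cs ds where
    "map Suc w = ps @ x # qs" "\<And>y. y \<in> set ps \<Longrightarrow> y < x"
    "insert_after 1 (length w + 3 - x) (map Suc w) = cs @ x # ds"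
    "\<And>y. y \<in> set cs \<Longrightarrow> y < x"
    "lr_child w x = cs @ (length w + 2) # x # ds"
    "map Suc w = rot (length w + 3) qs @ (length w + 3 - x) # rot (length w + 3) ps"
    "insert_after 1 (length w + 3 - x) (map Suc w) =
       rot (length w + 3) qs @ (length w + 3 - x) # 1 # rot (length w + 3) ps"
proof -
  let ?v = "map Suc w" and ?N = "length w + 3"
  let ?y = "?N - x"
  have v: "distinct ?v" "set ?v = {2..length w + 1}" "rot ?N ?v = ?v"
    using w by (auto simp: symmetric_baxter_map_Suc_iff)
  obtain ps qs where s: "?v = ps @ x # qs" "\<forall>y \<in> set ps. y < x"
    using x by (auto simp: lr_maxima_def)
  have "x \<in> set ?v" using s by simp
  then have x2: "2 \<le> x" "x \<le> length w + 1" using v(2) by auto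
  define cs where "cs = insert_after 1 ?y ps"
  \<comment> \<open>If \<open>?y = x\<close>, the new \<open>1\<close> is the first entry of
    \<open>ds\<close>; only the head \<open>x\<close> matters below.\<close>
  obtain ds where ds: "insert_after 1 ?y (x # qs) = x # ds"
    using insert_after_Cons_eq by metis
  have u: "insert_after 1 ?y ?v = cs @ x # ds"
    unfolding s(1) insert_after_append ds cs_def ..
  have cs: "y < x" if "y \<in> set cs" for y
    using that s(2) x2 set_insert_after_subset[of 1 ?y ps] by (auto simp: cs_def)
  have v': "?v = rot ?N qs @ ?y # rot ?N ps"
    using v(3) s(1) by (metis append.assoc append_Cons append_Nil rot_Cons rot_append)
  have "distinct (rot ?N qs @ ?y # rot ?N ps)" using v(1) v' by metis
  then have u': "insert_after 1 ?y ?v = rot ?N qs @ ?y # 1 # rot ?N ps"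
    unfolding v' by (simp add: insert_after_append insert_after_notin)
  have "1 \<notin> set ?v" using v(2) by simp
  then have "1 \<notin> set (rot ?N qs @ ?y # rot ?N ps)" using v' by metis
  with \<open>distinct (rot ?N qs @ ?y # rot ?N ps)\<close> have "distinct (insert_after 1 ?y ?v)"
    unfolding u' by auto
  then have "distinct (cs @ x # ds)" unfolding u .
  then have "lr_child w x = cs @ (length w + 2) # x # ds"
    unfolding lr_child_def u by (simp add: insert_before_append insert_before_notin)
  from that[OF s(1) _ u cs this v' u'] s(2) show ?thesis by blast
qed

lemma lr_child_symmetric_baxter:
  assumes w: "w \<in> symmetric_baxter" and x: "x \<in> lr_maxima (map Suc w)"
  shows "lr_child w x \<in> symmetric_baxter" "length (lr_child w x) = length w + 2"
    "delete_extremes (lr_child w x) = w"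
proof -
  let ?v = "map Suc w" and ?N = "length w + 3" and ?M = "length w + 2"
  let ?y = "?N - x"
  let ?u = "insert_after 1 ?y ?v"
  from lr_child_split[OF w x] obtain ps qs cs ds where s:
    "?v = ps @ x # qs" "\<And>y. y \<in> set ps \<Longrightarrow> y < x"
    "?u = cs @ x # ds" "\<And>y. y \<in> set cs \<Longrightarrow> y < x"
    "lr_child w x = cs @ ?M # x # ds"
    "?v = rot ?N qs @ ?y # rot ?N ps"
    "?u = rot ?N qs @ ?y # 1 # rot ?N ps" by blast
  have v: "distinct ?v" "set ?v = {2..length w + 1}" "avoids ?v" "rot ?N ?v = ?v"
    using w by (auto simp: symmetric_baxter_map_Suc_iff)
  have "x \<in> set ?v" using s(1) by simp
  then have x2: "2 \<le> x" "x \<le> length w + 1" using v(2) by auto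
  have v1: "1 \<notin> set ?v" using v(2) by simp
  have du: "distinct ?u" and su: "set ?u = insert 1 (set ?v)" and lu: "length ?u = length w + 1"
  proof -
    have "distinct (rot ?N qs @ ?y # rot ?N ps)" "1 \<notin> set (rot ?N qs @ ?y # rot ?N ps)"
      "length (rot ?N qs @ ?y # rot ?N ps) = length w"
      using v(1) v1 s(6) length_map by metis+
    then show "distinct ?u" "length ?u = length w + 1" unfolding s(7) by auto
    have "set ?u = insert 1 (set (rot ?N qs @ ?y # rot ?N ps))" unfolding s(7) by auto
    then show "set ?u = insert 1 (set ?v)" using s(6) by metis
  qed
  have Mu: "z < ?M" if "z \<in> set ?u" for z using that su v(2) by auto
  have u1: "set (cs @ x # ds) = insert 1 {2..length w + 1}" "distinct (cs @ x # ds)"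
    "length (cs @ x # ds) = length w + 1"
    using su v(2) du lu unfolding s(3) by simp_all
  have "?M \<notin> set (cs @ x # ds)" unfolding u1(1) by simp
  then have dc: "distinct (lr_child w x)" using u1(2) unfolding s(5) by auto
  have lc: "length (lr_child w x) = length w + 2" using u1(3) unfolding s(5) by simp
  have "set (lr_child w x) = insert ?M (set (cs @ x # ds))" unfolding s(5) by auto
  moreover have "insert ?M (insert 1 {2..length w + 1}) = {1..length w + 2}" by auto
  ultimately have sc': "set (lr_child w x) = {1..length w + 2}" using u1(1) by simp
  show "length (lr_child w x) = length w + 2" by (rule lc)
  \<comment> \<open>Truncated subtraction is injective only up to \<open>?N\<close>, hence the
    bounds in the next two facts. There \<open>?N - ?M = 1\<close>, so rotation exchanges the two
    insertions; as they commute and \<open>?v\<close> is fixed, so is the child.\<close>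
  have inj: "z = x'" if "z \<le> ?N" "x' \<le> ?N" "?N - z = ?N - x'" for z x' using that by linarith
  have rot_before: "rot ?N (insert_before ?M x l) = insert_after 1 ?y (rot ?N l)"
    if "\<And>z. z \<in> set l \<Longrightarrow> z \<le> ?N" for l
    using that x2 unfolding rot_def rev_insert_before
    by (subst map_insert_after) (auto intro: inj)
  have rot_after: "rot ?N (insert_after 1 ?y l) = insert_before ?M x (rot ?N l)"
    if "\<And>z. z \<in> set l \<Longrightarrow> z \<le> ?N" for l
    using that x2 unfolding rot_def rev_insert_after
    by (subst map_insert_before) (auto intro: inj)
  have "rot ?N (lr_child w x) = insert_after 1 ?y (rot ?N ?u)"
    unfolding lr_child_def by (intro rot_before) (drule Mu, simp)
  also have "rot ?N ?u = insert_before ?M x ?v"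
    using rot_after[of ?v] v(2,4) by auto
  also have "insert_after 1 ?y (insert_before ?M x ?v) = lr_child w x"
    unfolding lr_child_def using x2 by (intro insert_before_after_commute[symmetric]) auto
  finally have rc: "rot ?N (lr_child w x) = lr_child w x" .
  \<comment> \<open>Avoidance is obtained in three moves: insert only \<open>?M\<close>, rotate to
    see that inserting only \<open>1\<close> is safe, then insert \<open>?M\<close> into that list,
    where \<open>x\<close> is still a left-to-right maximum.\<close>
  have "avoids (ps @ ?M # x # qs)"
    using v(3) s(2) v(2) unfolding s(1) by (intro avoids_insert_max[of ps "x # qs"]) auto
  moreover have "insert_before ?M x ?v = ps @ ?M # x # qs"
    using v(1) unfolding s(1) by (simp add: insert_before_append insert_before_notin)
  ultimately have av: "avoids (insert_before ?M x ?v)" by simp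
  have u_rot: "?u = rot ?N (insert_before ?M x ?v)"
    using rot_before[of ?v] v(2,4) by auto
  have "z \<le> ?N" if "z \<in> set (insert_before ?M x ?v)" for z
    using subsetD[OF set_insert_before_subset that] v(2) by auto
  with av have "avoids ?u" unfolding u_rot by (rule avoids_rot)
  then have "avoids (cs @ ?M # x # ds)"
    using s(4) Mu unfolding s(3) by (intro avoids_insert_max[of cs "x # ds"]) auto
  then have ac: "avoids (lr_child w x)" using s(5) by simp
  show "lr_child w x \<in> symmetric_baxter"
    unfolding symmetric_baxter_iff lc using dc sc' ac rc by (simp add: numeral_3_eq_3)
  have "filter (\<lambda>z. z \<noteq> ?M) (lr_child w x) = ?u"
    using \<open>?M \<notin> set (cs @ x # ds)\<close> unfolding s(5) s(3) by (simp add: filter_neq_notin)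
  moreover have "filter (\<lambda>z. z \<noteq> 1) ?u = ?v"
  proof -
    have "1 \<notin> set (rot ?N qs @ ?y # rot ?N ps)" using v1 s(6) by metis
    then have "filter (\<lambda>z. z \<noteq> 1) ?u = rot ?N qs @ ?y # rot ?N ps"
      unfolding s(7) by (auto simp: filter_neq_notin)
    then show ?thesis using s(6) by metis
  qed
  ultimately have "filter (\<lambda>z. z \<noteq> 1) (filter (\<lambda>z. z \<noteq> ?M) (lr_child w x)) = ?v"
    by simp
  then have "map Suc (delete_extremes (lr_child w x)) = ?v"
    using map_Suc_delete_extremes[of "lr_child w x"] sc' lc by (simp add: conj_commute)
  then show "delete_extremes (lr_child w x) = w" by (metis inj_Suc inj_map_eq_map)
qed

text \<open>From the left, the new maximum hides everything behind it, leaving itself and the maxima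
  before \<open>x\<close>. From the right, entries before \<open>x\<close> were hidden already, so
  the new maximum is one extra; the new \<open>1\<close> is another exactly when it is last, that
  is, when \<open>x\<close> is first.\<close>

lemma label_lr_child:
  assumes w: "w \<in> symmetric_baxter" and x: "x \<in> lr_maxima (map Suc w)"
  defines "r \<equiv> Suc (card {z \<in> lr_maxima (map Suc w). z < x})"
  shows "label (lr_child w x) = (r, snd (label w) + (if r = 1 then 2 else 1))"
proof -
  let ?v = "map Suc w" and ?N = "length w + 3" and ?M = "length w + 2"
  let ?y = "?N - x"
  let ?u = "insert_after 1 ?y ?v"
  from lr_child_split[OF w x] obtain ps qs cs ds where s:
    "?v = ps @ x # qs" "\<And>y. y \<in> set ps \<Longrightarrow> y < x"
    "?u = cs @ x # ds" "\<And>y. y \<in> set cs \<Longrightarrow> y < x"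
    "lr_child w x = cs @ ?M # x # ds"
    "?v = rot ?N qs @ ?y # rot ?N ps"
    "?u = rot ?N qs @ ?y # 1 # rot ?N ps" by blast
  have v: "set ?v = {2..length w + 1}"
    using w by (auto simp: symmetric_baxter_map_Suc_iff)
  have v2: "1 < z" if "z \<in> set (rot ?N qs @ ?y # rot ?N ps)" for z
  proof -
    have "z \<in> set ?v" using s(6) that by metis
    then show ?thesis using v by auto
  qed
  have sub: "set ?u \<subseteq> {1..length w + 1}"
    using set_insert_after_subset[of 1 ?y ?v] v by auto
  then have Mu: "z < ?M" if "z \<in> set (cs @ x # ds)" for z
    using that s(3) by fastforce
  have lr_u: "lr_maxima ?u = lr_maxima ?v"
  proof -
    have "lr_maxima ((rot ?N qs @ [?y]) @ 1 # rot ?N ps) = lr_maxima ((rot ?N qs @ [?y]) @ rot ?N ps)"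
      using v2 by (intro lr_maxima_insert_small) auto
    then show ?thesis using s(6,7) by (metis append.assoc append_Cons append_Nil)
  qed
  have lr_rev_u: "lr_maxima (rev ?u) =
      (if ps = [] then insert 1 (lr_maxima (rev ?v)) else lr_maxima (rev ?v))"
  proof -
    have ru: "rev ?u = rev (rot ?N ps) @ 1 # ?y # rev (rot ?N qs)" unfolding s(7) by simp
    have rv: "rev ?v = rev (rot ?N ps) @ ?y # rev (rot ?N qs)" by (subst s(6)) simp
    show ?thesis
    proof (cases "ps = []")
      case True
      then have "rot ?N ps = []" by (simp add: rot_def)
      moreover have "lr_maxima (1 # ?y # rev (rot ?N qs)) =
          insert 1 (lr_maxima (?y # rev (rot ?N qs)))"
        using v2 by (intro lr_maxima_Cons_min) auto
      ultimately show ?thesis using True unfolding ru rv by simp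
    next
      case False
      then have "lr_maxima (rev (rot ?N ps) @ 1 # ?y # rev (rot ?N qs)) =
          lr_maxima (rev (rot ?N ps) @ ?y # rev (rot ?N qs))"
        using v2 by (intro lr_maxima_insert_small) (auto simp: rot_Nil_iff)
      then show ?thesis using False unfolding ru rv by simp
    qed
  qed
  have lr_cs: "lr_maxima cs = {z \<in> lr_maxima ?v. z < x}"
    unfolding lr_u[symmetric] s(3) using s(4) by (rule lr_maxima_append_Cons_max[symmetric])
  have "lr_maxima (lr_child w x) = insert ?M (lr_maxima cs)"
    unfolding s(5) using Mu by (rule lr_maxima_insert_max)
  moreover have "?M \<notin> lr_maxima cs" using Mu lr_maxima_subset[of cs] by fastforce
  ultimately have first: "card (lr_maxima (lr_child w x)) = r"
    by (simp add: r_def lr_cs finite_lr_maxima)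
  have "lr_maxima (rev (lr_child w x)) = insert ?M (lr_maxima (rev ds @ [x]))"
  proof -
    have "rev (lr_child w x) = (rev ds @ [x]) @ ?M # rev cs" unfolding s(5) by simp
    moreover have "lr_maxima ((rev ds @ [x]) @ ?M # rev cs) = insert ?M (lr_maxima (rev ds @ [x]))"
      by (rule lr_maxima_insert_max, rule Mu) auto
    ultimately show ?thesis by simp
  qed
  moreover have "lr_maxima (rev ?u) = lr_maxima (rev ds @ [x])"
  proof -
    have "rev ?u = (rev ds @ [x]) @ rev cs" unfolding s(3) by simp
    moreover have "lr_maxima ((rev ds @ [x]) @ rev cs) = lr_maxima (rev ds @ [x])"
      using s(4) by (intro lr_maxima_append_small) auto
    ultimately show ?thesis by simp
  qed
  moreover have "?M \<notin> lr_maxima (rev ?u)"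
    using sub lr_maxima_subset[of "rev ?u"] by fastforce
  ultimately have "card (lr_maxima (rev (lr_child w x))) = Suc (card (lr_maxima (rev ?u)))"
    by (simp add: finite_lr_maxima)
  moreover have "1 \<notin> lr_maxima (rev ?v)"
    using v lr_maxima_subset[of "rev ?v"] by fastforce
  \<comment> \<open>A nonempty prefix contains a left-to-right maximum, which then lies below
    \<open>x\<close>.\<close>
  moreover have "ps = [] \<longleftrightarrow> r = 1"
  proof -
    have "{z \<in> lr_maxima ?v. z < x} = lr_maxima ps"
      unfolding s(1) using s(2) by (rule lr_maxima_append_Cons_max)
    then show ?thesis by (simp add: r_def finite_lr_maxima lr_maxima_eq_empty)
  qed
  moreover have "card (lr_maxima (rev ?v)) = snd (label w)"
    unfolding rev_map lr_maxima_map_Suc label_def by (simp add: card_image)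
  ultimately have "card (lr_maxima (rev (lr_child w x))) = snd (label w) + (if r = 1 then 2 else 1)"
    using lr_rev_u by (simp add: finite_lr_maxima)
  with first show ?thesis by (simp add: label_def)
qed

text \<open>Rotation symmetry places \<open>1\<close> directly after the image of \<open>x\<close>,
  so deleting and reinserting both extremes restores \<open>w\<close>. Length 2 is excluded because
  of \<open>21\<close>, whose parent is empty.\<close>

lemma symmetric_baxter_eq_lr_child:
  assumes w: "w \<in> symmetric_baxter" and len: "length w > 2"
    and split: "w = cs @ length w # x # ds" and cs: "\<And>y. y \<in> set cs \<Longrightarrow> y < x"
  shows "\<exists>z \<in> lr_maxima (map Suc (delete_extremes w)). w = lr_child (delete_extremes w) z"
proof -
  let ?M = "length w" and ?N = "length w + 1"
  have p: "distinct w" "set w = {1..?M}" "rot ?N w = w"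
    using w by (auto simp: symmetric_baxter_iff)
  have len': "length (delete_extremes w) + 2 = ?M"
    using delete_extremes_symmetric_baxter(2)[OF w] len by simp
  have x: "1 \<le> x" "x \<le> ?M" "x \<noteq> ?M"
  proof -
    have "x \<in> set w" by (subst split) simp
    then show "1 \<le> x" "x \<le> ?M" using p(2) by auto
    have "distinct (cs @ ?M # x # ds)" using p(1) split by metis
    then show "x \<noteq> ?M" by auto
  qed
  have rsplit: "w = rot ?N ds @ (?N - x) # 1 # rot ?N cs"
  proof -
    have "w = rot ?N (cs @ ?M # x # ds)" using p(3) split by metis
    then show ?thesis by (simp add: rot_append rot_Cons)
  qed
  \<comment> \<open>Otherwise \<open>cs\<close> is empty and \<open>w\<close> begins with its
    maximum followed by \<open>1\<close>; by symmetry it also ends with \<open>1\<close>, so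
    \<open>1\<close> would occur twice.\<close>
  have "x \<noteq> 1"
  proof
    assume x1: "x = 1"
    have "cs = []"
    proof (rule ccontr)
      assume "cs \<noteq> []"
      then obtain y where y: "y \<in> set cs" by (cases cs) auto
      then have "y \<in> set w" by (subst split) simp
      then show False using cs[OF y] p(2) x1 by auto
    qed
    then have "w = (rot ?N ds @ [?M]) @ [1]" using rsplit x1 by (simp add: rot_def)
    then have "last w = 1" by (metis last_snoc)
    moreover have "w = ?M # 1 # ds" using split \<open>cs = []\<close> x1 by simp
    moreover then have "ds \<noteq> []" using len
      by (metis One_nat_def Suc_1 length_Cons less_irrefl list.size(3))
    ultimately have "1 \<in> set ds" by (metis last_ConsR last_in_set list.distinct(1))
    then show False using p(1) \<open>w = ?M # 1 # ds\<close> by (metis distinct.simps(2))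
  qed
  let ?u = "filter (\<lambda>z. z \<noteq> ?M) w"
  let ?v = "filter (\<lambda>z. z \<noteq> 1) ?u"
  have v: "map Suc (delete_extremes w) = ?v"
    unfolding map_Suc_delete_extremes[OF p(2)] filter_filter by (simp add: conj_commute)
  have "insert_before ?M x ?u = w" using split p(1) by (rule insert_before_filter)
  moreover have "insert_after 1 (?N - x) ?v = ?u"
  proof (rule insert_after_filter)
    have "?u = filter (\<lambda>z. z \<noteq> ?M) (rot ?N ds @ (?N - x) # 1 # rot ?N cs)"
      by (subst rsplit) rule
    also have "\<dots> = filter (\<lambda>z. z \<noteq> ?M) (rot ?N ds) @ (?N - x) # 1 #
        filter (\<lambda>z. z \<noteq> ?M) (rot ?N cs)"
      \<comment> \<open>\<open>x \<noteq> 1\<close> means \<open>?N - x \<noteq> ?M\<close>, so the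
        left neighbour of \<open>1\<close> survives the deletion of \<open>?M\<close>.\<close>
      using x \<open>x \<noteq> 1\<close> len by auto
    finally show "?u = filter (\<lambda>z. z \<noteq> ?M) (rot ?N ds) @ (?N - x) # 1 #
        filter (\<lambda>z. z \<noteq> ?M) (rot ?N cs)" .
  qed (use p(1) in simp)
  ultimately have "lr_child (delete_extremes w) x = w"
    unfolding lr_child_def v using len' by (metis add.assoc nat_1_add_1 numeral_Bit1 numerals(1))
  moreover have "x \<in> lr_maxima ?v"
  proof -
    have "?v = filter (\<lambda>z. z \<noteq> 1) (filter (\<lambda>z. z \<noteq> ?M) (cs @ ?M # x # ds))"
      by (subst split) rule
    also have "\<dots> = filter (\<lambda>z. z \<noteq> 1) (filter (\<lambda>z. z \<noteq> ?M) cs) @ x #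
        filter (\<lambda>z. z \<noteq> 1) (filter (\<lambda>z. z \<noteq> ?M) ds)"
      using x \<open>x \<noteq> 1\<close> by simp
    finally show ?thesis using cs by (auto simp: lr_maxima_append lr_maxima_Cons)
  qed
  ultimately show ?thesis unfolding v by metis
qed

definition children :: "nat list \<Rightarrow> nat list set" where
  "children w = {c \<in> symmetric_baxter. length c \<ge> 2 \<and> delete_extremes c = w}"

text \<open>In a child the maximum must occupy an insertion site; the two kinds of site give the two
  families, the second through reversal. Nonemptiness of \<open>w\<close> makes children longer than
  2.\<close>

lemma children_eq:
  assumes w: "w \<in> symmetric_baxter" and ne: "w \<noteq> []"
  shows "children w = lr_child w ` lr_maxima (map Suc w) \<union>
    (\<lambda>x. rev (lr_child (rev w) x)) ` lr_maxima (map Suc (rev w))"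
proof (intro equalityI subsetI)
  fix c assume "c \<in> children w"
  then have c: "c \<in> symmetric_baxter" "length c \<ge> 2" "delete_extremes c = w"
    by (auto simp: children_def)
  have len: "length c > 2"
    using delete_extremes_symmetric_baxter(2)[OF c(1,2)] c(3) ne by (cases w) auto
  have p: "distinct c" "set c = {1..length c}" "avoids c"
    using c(1) by (auto simp: symmetric_baxter_iff)
  have "length c \<in> set c" unfolding p(2) using len by simp
  then obtain xs ys where s: "c = xs @ length c # ys" by (metis in_set_conv_decomp)
  have "distinct (xs @ length c # ys)" using p(1) s by metis
  then have d: "distinct (xs @ ys)" "length c \<notin> set (xs @ ys)" by auto
  have M: "z < length c" if "z \<in> set (xs @ ys)" for z
  proof -
    have "z \<in> set c" using that by (subst s) auto
    then show ?thesis using p(2) d(2) that by (metis atLeastAtMost_iff le_neq_implies_less)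
  qed
  have "length c = length (xs @ length c # ys)" using s by (rule arg_cong)
  then have "xs @ ys \<noteq> []" using len by auto
  moreover have "avoids (xs @ length c # ys)" using p(3) s by metis
  ultimately have "insertion_site xs ys" using M d(1) by (intro avoids_insert_max_site)
  then consider "ys \<noteq> []" "\<forall>x \<in> set xs. x < hd ys" | "xs \<noteq> []" "\<forall>y \<in> set ys. y < last xs"
    by (auto simp: insertion_site_def)
  then show "c \<in> lr_child w ` lr_maxima (map Suc w) \<union>
    (\<lambda>x. rev (lr_child (rev w) x)) ` lr_maxima (map Suc (rev w))"
  proof cases
    case 1
    then have "c = xs @ length c # hd ys # tl ys" using s by simp
    then show ?thesis
      using symmetric_baxter_eq_lr_child[OF c(1) len, of xs "hd ys" "tl ys"] 1 c(3) by blast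
  next
    case 2
    have "rev c = rev ys @ length c # rev xs" by (subst s) simp
    moreover have "rev xs = last xs # rev (butlast xs)"
      using 2 by (metis append_butlast_last_id rev_eq_Cons_iff rev_rev_ident)
    ultimately have "rev c = rev ys @ length (rev c) # last xs # rev (butlast xs)"
      by (metis length_rev)
    from symmetric_baxter_eq_lr_child[OF rev_symmetric_baxter[OF c(1)] _ this] 2 len
    obtain z where "z \<in> lr_maxima (map Suc (rev w))" "rev c = lr_child (rev w) z"
      unfolding delete_extremes_rev c(3) by auto
    then show ?thesis by (metis UnCI image_eqI rev_rev_ident)
  qed
next
  fix c assume "c \<in> lr_child w ` lr_maxima (map Suc w) \<union>
    (\<lambda>x. rev (lr_child (rev w) x)) ` lr_maxima (map Suc (rev w))"
  then show "c \<in> children w"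
    using lr_child_symmetric_baxter[OF w] lr_child_symmetric_baxter[OF rev_symmetric_baxter[OF w]]
    by (auto simp: children_def rev_symmetric_baxter delete_extremes_rev)
qed

section \<open>Ranks of maxima and labels of children\<close>

lemma bij_betw_rank:
  fixes A :: "nat set"
  assumes "finite A"
  shows "bij_betw (\<lambda>x. Suc (card {z \<in> A. z < x})) A {1..card A}"
proof -
  let ?r = "\<lambda>x. Suc (card {z \<in> A. z < x})"
  have less: "?r x < ?r y" if "x \<in> A" "x < y" for x y
  proof -
    have "{z \<in> A. z < x} \<subset> {z \<in> A. z < y}" using that by auto
    then show ?thesis using assms by (simp add: psubset_card_mono)
  qed
  have inj: "inj_on ?r A"
  proof (rule inj_onI)
    fix x y assume "x \<in> A" "y \<in> A" "?r x = ?r y"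
    then show "x = y" using less[of x y] less[of y x] by (cases x y rule: linorder_cases) auto
  qed
  have "?r x \<le> card A" if "x \<in> A" for x
  proof -
    have "{z \<in> A. z < x} \<subset> A" using that by auto
    then have "card {z \<in> A. z < x} < card A" using assms by (rule psubset_card_mono[rotated])
    then show ?thesis by simp
  qed
  then have "?r ` A \<subseteq> {1..card A}" by auto
  moreover have "card (?r ` A) = card {1..card A}" using card_image[OF inj] by simp
  ultimately have "?r ` A = {1..card A}" by (intro card_subset_eq) auto
  with inj show ?thesis by (simp add: bij_betw_def)
qed

lemma distinct_child_labels: "distinct (child_labels l)"
  by (cases l) (auto simp: distinct_map inj_on_def)

text \<open>Rewrites the succession rule as two mirror-image families indexed by rank, the shape
  produced by \<open>label_lr_child\<close> and its reversal.\<close>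

lemma set_child_labels:
  assumes "i \<ge> 1" "j \<ge> 1"
  shows "set (child_labels (i, j)) = (\<lambda>r. (r, j + (if r = 1 then 2 else 1))) ` {1..i} \<union>
    (\<lambda>r. (i + (if r = 1 then 2 else 1), r)) ` {1..j}"
proof -
  have "{1..i} = insert 1 {2..<i + 1}" "{1..j} = insert 1 {2..<j + 1}" using assms by auto
  then show ?thesis using assms by (auto simp: image_iff)
qed

lemma bij_betw_label_children:
  assumes w: "w \<in> symmetric_baxter"
  shows "bij_betw label (children w) (set (child_labels (label w)))"
proof (cases "w = []")
  case True
  \<comment> \<open>The empty permutation has no maxima to insert next to, so its children are found
    directly.\<close>
  have "children [] = {[1, 2], [2, 1]}"
  proof (intro equalityI subsetI)
    fix c assume "c \<in> children []"
    then have c: "c \<in> symmetric_baxter" "length c = 2"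
      using delete_extremes_symmetric_baxter(2)[of c] by (auto simp: children_def)
    then obtain a b where ab: "c = [a, b]" by (auto simp: numeral_2_eq_2 length_Suc_conv)
    have "{1..2} = {1, 2 :: nat}" by auto
    with c(1) ab have "a \<noteq> b" "{a, b} = {1, 2}"
      by (simp_all add: symmetric_baxter_iff numeral_2_eq_2)
    with ab show "c \<in> {[1, 2], [2, 1]}" by (auto simp: doubleton_eq_iff)
  next
    fix c :: "nat list" assume "c \<in> {[1, 2], [2, 1]}"
    moreover have "{1, 2} = {1..2 :: nat}" "{2, 1} = {1..2 :: nat}" by auto
    ultimately show "c \<in> children []"
      by (auto simp: children_def symmetric_baxter_iff avoids_short rot_def delete_extremes_def)
  qed
  moreover have "label [] = (0, 0)" "label [1, 2] = (2, 1)" "label [2, 1] = (1, 2)"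
  proof -
    have "lr_maxima [1, 2] = {1, 2}" "lr_maxima [2, 1] = {2}" by (auto simp: lr_maxima_Cons)
    then show "label [] = (0, 0)" "label [1, 2] = (2, 1)" "label [2, 1] = (1, 2)"
      by (simp_all add: label_def)
  qed
  ultimately show ?thesis using True by (auto simp: bij_betw_def)
next
  case False
  let ?A = "lr_maxima (map Suc w)" and ?B = "lr_maxima (map Suc (rev w))"
  obtain i j where ij: "label w = (i, j)" by (cases "label w")
  have card: "card ?A = i" "card ?B = j"
    using ij by (simp_all add: label_def lr_maxima_map_Suc card_image)
  have ij1: "i \<ge> 1" "j \<ge> 1"
    using card False by (auto simp: Suc_le_eq card_gt_0_iff finite_lr_maxima lr_maxima_eq_empty)
  let ?r = "\<lambda>x. Suc (card {z \<in> ?A. z < x})" and ?s = "\<lambda>x. Suc (card {z \<in> ?B. z < x})"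
  have r: "bij_betw ?r ?A {1..i}" and s: "bij_betw ?s ?B {1..j}"
    using bij_betw_rank[OF finite_lr_maxima] card by metis+
  let ?f = "\<lambda>r. (r, j + (if r = 1 then 2 else 1))" and ?g = "\<lambda>r. (i + (if r = 1 then 2 else 1), r)"
  have l1: "label (lr_child w x) = ?f (?r x)" if "x \<in> ?A" for x
    using label_lr_child[OF w that] ij by simp
  have l2: "label (rev (lr_child (rev w) x)) = ?g (?s x)" if "x \<in> ?B" for x
    using label_lr_child[OF rev_symmetric_baxter[OF w] that] ij by (simp add: label_rev)
  have ch: "children w = lr_child w ` ?A \<union> (\<lambda>x. rev (lr_child (rev w) x)) ` ?B"
    using w False by (rule children_eq)
  have rA: "?r x \<le> i" if "x \<in> ?A" for x using bij_betwE[OF r] that by auto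
  show ?thesis
    unfolding bij_betw_def
  proof
    have eq1: "x = y" if "x \<in> ?A" "y \<in> ?A" "?r x = ?r y" for x y
      using bij_betw_imp_inj_on[OF r] that by (auto dest: inj_onD)
    have eq2: "x = y" if "x \<in> ?B" "y \<in> ?B" "?s x = ?s y" for x y
      using bij_betw_imp_inj_on[OF s] that by (auto dest: inj_onD)
    \<comment> \<open>The two families are told apart by the first component: at most
      \<open>i\<close> in one, above \<open>i\<close> in the other.\<close>
    have neq: "?f (?r x) \<noteq> ?g (?s y)" if "x \<in> ?A" for x y
      using rA[OF that] by auto
    show "inj_on label (children w)"
    proof (rule inj_onI)
      fix c d assume cd: "c \<in> children w" "d \<in> children w" "label c = label d"
      from cd(1) consider x where "x \<in> ?A" "c = lr_child w x"
        | x where "x \<in> ?B" "c = rev (lr_child (rev w) x)" unfolding ch by blast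
      note c = this
      from cd(2) consider x where "x \<in> ?A" "d = lr_child w x"
        | x where "x \<in> ?B" "d = rev (lr_child (rev w) x)" unfolding ch by blast
      note d = this
      show "c = d"
      proof (cases rule: c)
        case c1: (1 x)
        have lc: "label c = ?f (?r x)" using l1[OF c1(1)] c1(2) by (simp only:)
        show ?thesis
        proof (cases rule: d)
          case d1: (1 y)
          have "label d = ?f (?r y)" using l1[OF d1(1)] d1(2) by (simp only:)
          then have "?r x = ?r y" using lc cd(3) by (metis prod.inject)
          with eq1[OF c1(1) d1(1)] c1(2) d1(2) show ?thesis by (simp only:)
        next
          case d2: (2 y)
          have "label d = ?g (?s y)" using l2[OF d2(1)] d2(2) by (simp only:)
          then show ?thesis using neq[OF c1(1), of y] lc cd(3) by metis
        qed
      next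
        case c2: (2 x)
        have lc: "label c = ?g (?s x)" using l2[OF c2(1)] c2(2) by (simp only:)
        show ?thesis
        proof (cases rule: d)
          case d1: (1 y)
          have "label d = ?f (?r y)" using l1[OF d1(1)] d1(2) by (simp only:)
          then show ?thesis using neq[OF d1(1), of x] lc cd(3) by metis
        next
          case d2: (2 y)
          have "label d = ?g (?s y)" using l2[OF d2(1)] d2(2) by (simp only:)
          then have "?s x = ?s y" using lc cd(3) by (metis prod.inject)
          with eq2[OF c2(1) d2(1)] c2(2) d2(2) show ?thesis by (simp only:)
        qed
      qed
    qed
    have "label ` children w = ?f ` ?r ` ?A \<union> ?g ` ?s ` ?B"
      unfolding ch image_Un image_image by (intro arg_cong2[of _ _ _ _ "(\<union>)"] image_cong refl l1 l2)
    also have "\<dots> = set (child_labels (i, j))"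
      unfolding bij_betw_imp_surj_on[OF r] bij_betw_imp_surj_on[OF s]
      using set_child_labels[OF ij1] by simp
    finally show "label ` children w = set (child_labels (label w))" using ij by simp
  qed
qed

section \<open>The isomorphism\<close>

lemma symmetric_baxter_small: "[] \<in> symmetric_baxter" "[1] \<in> symmetric_baxter"
  by (simp_all add: symmetric_baxter_iff avoids_short rot_def)

text \<open>\<open>P\<close> stands for a parity. Each deletion shortens by two within
  \<open>V\<close>, so induction on length leads down to \<open>r\<close>, the only member too short
  to have a parent.\<close>

lemma rooted_tree_deletion_tree:
  assumes V: "V = {w \<in> symmetric_baxter. P (length w)}" and P: "\<And>n. P (n + 2) \<longleftrightarrow> P n"
    and r: "\<And>w. w \<in> V \<and> length w < 2 \<longleftrightarrow> w = r"
  shows "rooted_tree (deletion_tree V r)"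
proof -
  let ?E = "{(delete_extremes w, w) | w. w \<in> V \<and> length w \<ge> 2}"
  have del: "delete_extremes w \<in> V" "length (delete_extremes w) + 2 = length w"
    if "w \<in> V" "length w \<ge> 2" for w
    using delete_extremes_symmetric_baxter[of w] that P[of "length (delete_extremes w)"]
    by (auto simp: V)
  have reach: "(r, w) \<in> ?E\<^sup>*" if "w \<in> V" for w
    using that
  proof (induction w rule: measure_induct_rule[of length])
    case (less w)
    show ?case
    proof (cases "length w < 2")
      case True
      then have "w = r" using r[of w] less.prems by simp
      then show ?thesis by simp
    next
      case False
      then have "(r, delete_extremes w) \<in> ?E\<^sup>*" "(delete_extremes w, w) \<in> ?E"
        using less.IH[of "delete_extremes w"] less.prems del[of w] by auto
      then show ?thesis by (rule rtrancl_into_rtrancl)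
    qed
  qed
  have rV: "r \<in> V" "length r < 2" using r[of r] by simp_all
  have "\<exists>!u. (u, v) \<in> ?E" if "v \<in> V - {r}" for v
    using that r[of v] by (auto simp: not_less)
  then show ?thesis
    using rV reach del by (auto simp: rooted_tree_def deletion_tree_def)
qed

lemma deletion_tree_isomorphic:
  assumes V: "V = {w \<in> symmetric_baxter. P (length w)}" and P: "\<And>n. P (n + 2) \<longleftrightarrow> P n"
    and r: "\<And>w. w \<in> V \<and> length w < 2 \<longleftrightarrow> w = r"
  shows "rooted_tree_isomorphic (deletion_tree V r) (generating_tree child_labels (label r))"
proof -
  have T: "rooted_tree (deletion_tree V r)" using assms by (rule rooted_tree_deletion_tree)
  have "{c. (w, c) \<in> arcs (deletion_tree V r)} = children w" if "w \<in> V" for w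
  proof -
    \<comment> \<open>Children inherit the parity, so restricting to \<open>V\<close> loses none of
      them.\<close>
    have "P (length c)" if "c \<in> children w" for c
      using that \<open>w \<in> V\<close> delete_extremes_symmetric_baxter(2)[of c] P[of "length w"]
      by (auto simp: V children_def)
    then show ?thesis by (auto simp: deletion_tree_def children_def V)
  qed
  then have "rooted_tree_isomorphic (deletion_tree V r)
      (generating_tree child_labels (label (root (deletion_tree V r))))"
    using bij_betw_label_children
    by (intro rooted_tree_isomorphic_generating_tree[OF T] distinct_child_labels)
      (auto simp: deletion_tree_def V)
  then show ?thesis by (simp add: deletion_tree_def)
qed

theorem theorem4p2:
  shows "rooted_tree_isomorphic T_odd A_odd \<and> rooted_tree_isomorphic T_even A_even"
proof
  have len1: "w = [1]" if "w \<in> symmetric_baxter" "odd (length w)" "length w < 2" for w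
  proof -
    have "length w = 1" using that by presburger
    then show ?thesis
      using that(1) by (auto simp: symmetric_baxter_iff length_Suc_conv)
  qed
  have "rooted_tree_isomorphic (deletion_tree {w \<in> symmetric_baxter. odd (length w)} [1])
      (generating_tree child_labels (label [1]))"
  proof (rule deletion_tree_isomorphic[OF refl])
    show "w \<in> {w \<in> symmetric_baxter. odd (length w)} \<and> length w < 2 \<longleftrightarrow> w = [1]" for w
      using len1[of w] symmetric_baxter_small(2) by auto
  qed simp
  \<comment> \<open>Here \<open>label [1]\<close> evaluates to \<open>(1, 1)\<close>, the prescribed
    root label.\<close>
  then show "rooted_tree_isomorphic T_odd A_odd"
    by (simp add: T_odd_def A_odd_def symmetric_baxter_def label_def lr_maxima_Cons conj_assoc)
  have "rooted_tree_isomorphic (deletion_tree {w \<in> symmetric_baxter. even (length w)} [])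
      (generating_tree child_labels (label []))"
  proof (rule deletion_tree_isomorphic[OF refl])
    show "w \<in> {w \<in> symmetric_baxter. even (length w)} \<and> length w < 2 \<longleftrightarrow> w = []" for w
      using symmetric_baxter_small(1) by (auto simp: less_2_cases_iff)
  qed simp
  then show "rooted_tree_isomorphic T_even A_even"
    by (simp add: T_even_def A_even_def symmetric_baxter_def label_def conj_assoc)
qed

end
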